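(* For all $a,b\in\{1,\dots,D\}$ and all $k$, the quasi-tau matrices $H_{[k]}$ (as functions of $m\in\mathbb Z^D$) satisfy $$\begin{aligned}\Delta_b\big((\Delta_aH_{[k]})H_{[k]}^{-1}\big)=\;&(n_a\cdot\Lambda)_{[k],[k+1]}H_{[k+1]}\big[(n_b\cdot\Lambda)_{[k],[k+1]}\big]^\top(T_bH_{[k]})^{-1}\\&-(T_aH_{[k]})\big[(n_b\cdot\Lambda)_{[k-1],[k]}\big]^\top(T_aT_bH_{[k-1]})^{-1}(n_a\cdot\Lambda)_{[k-1],[k]},\end{aligned}$$ and the matrices $\beta_{[k]}$ satisfy $$\begin{aligned}&\big((T_b\beta_{[k]})(n_b\cdot\Lambda)_{[k-1],[k]}-(n_b\cdot\Lambda)_{[k],[k+1]}\beta_{[k+1]}-q_b\big)(\Delta_a\beta_{[k]})\\&\quad=(T_b\Delta_a\beta_{[k]})\big((T_aT_b\beta_{[k-1]})(n_b\cdot\Lambda)_{[k-2],[k-1]}-(n_b\cdot\Lambda)_{[k-1],[k]}(T_a\beta_{[k]})-q_b\big).\end{aligned}$$ (Terms containing a block with a negative index, or $\beta_{[0]}$, are absent.)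
   Context: Let $D\ge 1$. For $k\in\mathbb Z_+$ let $[k]=\{\alpha\in\mathbb Z_+^D:|\alpha|=k\}$, ordered so that $\alpha>\alpha'$ iff at the first coordinate where they differ the entry of $\alpha$ is smaller. $\chi_{[k]}(x)$ is the column vector of monomials $x^\alpha$, $\alpha\in[k]$, and $\chi$ stacks $\chi_{[0]},\chi_{[1]},\dots$. Semi-infinite matrices are partitioned in blocks $A_{[k],[\ell]}\in\mathbb R^{|[k]|\times|[\ell]|}$. Shift matrices: $\Lambda_a$, $a=1,\dots,D$, has as only nonzero blocks $(\Lambda_a)_{[k],[k+1]}$, with entries $\delta_{\alpha+e_a,\alpha'}$, $\alpha\in[k]$, $\alpha'\in[k+1]$; $n\cdot\Lambda=\sum_bn_b\Lambda_b$ for $n\in\mathbb R^D$. Discrete flows: fix an invertible matrix $N=(n_{a,b})\in GL(\mathbb R^D)$ with rows giving the vectors $n_a=(n_{a,1},\dots,n_{a,D})^\top$, and $q=(q_1,\dots,q_D)\in\mathbb R^D$ with all $q_a\ne0$. Let $\mu$ be a Borel measure with finite moments and $\operatorname{supp}\mu\subset\{x\in\mathbb R^D:|n_a\cdot x|<|q_a|,\ a=1,\dots,D\}$. For $m\in\mathbb Z^D$ put $d\mu_m(x)=\big[\prod_{a=1}^D(n_a\cdot x-q_a)^{m_a}\big]d\mu(x)$, with moment matrix $G(m)=\int\chi\,d\mu_m\,\chi^\top$. It is assumed that for each $m$ there is a block Cholesky factorization $G(m)=S(m)^{-1}H(m)(S(m)^{-1})^\top$ with $S(m)$ block lower triangular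 with identity diagonal blocks and $H(m)=\operatorname{diag}(H_{[0]}(m),H_{[1]}(m),\dots)$ with invertible blocks (the quasi-tau matrices). $\beta_{[k]}=S_{[k],[k-1]}$, $k\ge1$. For functions of $m$: $(T_af)(m)=f(m+e_a)$, $\Delta_a=T_a-1$. The dependence on $m$ is omitted. *)

theory Defs
  imports
    "HOL-Analysis.Analysis"
    "Jordan_Normal_Form.Gauss_Jordan_Elimination"
begin

text \<open>The dimension \<open>D\<close> is \<open>CARD('d)\<close> for a finite, linearly ordered index type \<open>'d\<close>.
  From here on \<open>$\<close> and \<open>\<bullet>\<close> refer to \<open>real ^ 'd\<close> and friends, not to \<open>'a Matrix.vec\<close>.\<close>

no_notation Matrix.vec_index (infixl \<open>$\<close> 100)
no_notation Matrix.scalar_prod (infix \<open>\<bullet>\<close> 70)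

type_synonym 'd midx = "nat ^ 'd"

definition mdeg :: "('d::finite) midx \<Rightarrow> nat" where
  "mdeg \<alpha> = (\<Sum>i\<in>UNIV. \<alpha> $ i)"

definition level :: "nat \<Rightarrow> ('d::finite) midx set" where
  "level k = {\<alpha>. mdeg \<alpha> = k}"

text \<open>\<open>midx_less \<alpha> \<beta>\<close> means that \<open>\<alpha>\<close> comes before \<open>\<beta>\<close>: at the first coordinate where they
  differ, the entry of \<open>\<beta>\<close> is the smaller one.\<close>

definition midx_less :: "('d::{finite,linorder}) midx \<Rightarrow> 'd midx \<Rightarrow> bool" where
  "midx_less \<alpha> \<beta> \<longleftrightarrow> (\<exists>i. (\<forall>j<i. \<alpha> $ j = \<beta> $ j) \<and> \<beta> $ i < \<alpha> $ i)"

definition level_list :: "nat \<Rightarrow> ('d::{finite,linorder}) midx list" where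
  "level_list k = (THE xs. sorted_wrt midx_less xs \<and> set xs = level k)"

text \<open>Semi-infinite matrices are indexed by multi-indices; \<open>blk A k l\<close> is the block
  \<open>A\<^bsub>[k],[l]\<^esub>\<close> as an ordinary matrix of size \<open>|[k]| \<times> |[l]|\<close>.\<close>

type_synonym 'd smat = "'d midx \<Rightarrow> 'd midx \<Rightarrow> real"

definition blk :: "('d::{finite,linorder}) smat \<Rightarrow> nat \<Rightarrow> nat \<Rightarrow> real mat" where
  "blk A k l = Matrix.mat (card (level k :: 'd midx set)) (card (level l :: 'd midx set))
     (\<lambda>(i, j). A (level_list k ! i) (level_list l ! j))"

text \<open>The product is meant for factors for which every entry is a sum with finitely many nonzero
  terms, as is the case for all products formed below.\<close>

definition sm_mult :: "('d::finite) smat \<Rightarrow> 'd smat \<Rightarrow> 'd smat" where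
  "sm_mult A B = (\<lambda>\<alpha> \<beta>. \<Sum>\<gamma> | A \<alpha> \<gamma> * B \<gamma> \<beta> \<noteq> 0. A \<alpha> \<gamma> * B \<gamma> \<beta>)"

definition sm_one :: "('d::finite) smat" where
  "sm_one = (\<lambda>\<alpha> \<beta>. if \<alpha> = \<beta> then 1 else 0)"

definition sm_transpose :: "('d::finite) smat \<Rightarrow> 'd smat" where
  "sm_transpose A = (\<lambda>\<alpha> \<beta>. A \<beta> \<alpha>)"

definition sm_inverse_of :: "('d::finite) smat \<Rightarrow> 'd smat \<Rightarrow> bool" where
  "sm_inverse_of A R \<longleftrightarrow> sm_mult A R = sm_one \<and> sm_mult R A = sm_one"

definition block_unitriangular :: "('d::{finite,linorder}) smat \<Rightarrow> bool" where
  "block_unitriangular S \<longleftrightarrow>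
     (\<forall>k l. k < l \<longrightarrow>
        blk S k l = 0\<^sub>m (card (level k :: 'd midx set)) (card (level l :: 'd midx set))) \<and>
     (\<forall>k. blk S k k = 1\<^sub>m (card (level k :: 'd midx set)))"

definition block_diagonal :: "('d::{finite,linorder}) smat \<Rightarrow> bool" where
  "block_diagonal H \<longleftrightarrow>
     (\<forall>k l. k \<noteq> l \<longrightarrow>
        blk H k l = 0\<^sub>m (card (level k :: 'd midx set)) (card (level l :: 'd midx set)))"

text \<open>\<open>G = S\<^sup>-\<^sup>1 H (S\<^sup>-\<^sup>1)\<^sup>T\<close>, where \<open>R\<close> is the two-sided (hence unique) inverse of \<open>S\<close>.\<close>

definition block_cholesky ::
    "('d::{finite,linorder}) smat \<Rightarrow> 'd smat \<Rightarrow> 'd smat \<Rightarrow> bool" where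
  "block_cholesky G S H \<longleftrightarrow>
     block_unitriangular S \<and> block_diagonal H \<and> (\<forall>k. invertible_mat (blk H k k)) \<and>
     (\<exists>R. sm_inverse_of S R \<and> G = sm_mult (sm_mult R H) (sm_transpose R))"

definition Lambda :: "'d::finite \<Rightarrow> 'd smat" where
  "Lambda a = (\<lambda>\<alpha> \<alpha>'. if \<alpha> + axis a 1 = \<alpha>' then 1 else 0)"

definition dot_Lambda :: "real ^ 'd \<Rightarrow> ('d::finite) smat" where
  "dot_Lambda v = (\<lambda>\<alpha> \<alpha>'. \<Sum>b\<in>UNIV. v $ b * Lambda b \<alpha> \<alpha>')"

definition chi :: "real ^ 'd \<Rightarrow> ('d::finite) midx \<Rightarrow> real" where
  "chi x \<alpha> = (\<Prod>i\<in>UNIV. (x $ i) ^ (\<alpha> $ i))"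

definition msupport :: "'a::topological_space measure \<Rightarrow> 'a set" where
  "msupport M = {x. \<forall>U. open U \<and> x \<in> U \<longrightarrow> emeasure M U \<noteq> 0}"

definition finite_moments :: "(real ^ 'd::finite) measure \<Rightarrow> bool" where
  "finite_moments M \<longleftrightarrow> (\<forall>\<alpha>. integrable M (\<lambda>x. chi x \<alpha>))"

definition flow_weight ::
    "real ^ 'd ^ 'd \<Rightarrow> real ^ 'd \<Rightarrow> int ^ 'd \<Rightarrow> real ^ 'd \<Rightarrow> real" where
  "flow_weight N q m x = (\<Prod>a\<in>UNIV. ((N $ a) \<bullet> x - q $ a) powi (m $ a))"

text \<open>The weight may be negative, so \<open>d\<mu>\<^sub>m\<close> is in general a signed measure; integrals against it
  are written as integrals of the weighted integrand against \<open>\<mu>\<close>.\<close>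

definition moment_matrix ::
    "(real ^ 'd) measure \<Rightarrow> real ^ 'd ^ 'd \<Rightarrow> real ^ 'd \<Rightarrow> int ^ 'd \<Rightarrow> ('d::finite) smat" where
  "moment_matrix \<mu> N q m =
     (\<lambda>\<alpha> \<beta>. integral\<^sup>L \<mu> (\<lambda>x. chi x \<alpha> * chi x \<beta> * flow_weight N q m x))"

definition fshift :: "'d::finite \<Rightarrow> (int ^ 'd \<Rightarrow> 'b) \<Rightarrow> int ^ 'd \<Rightarrow> 'b" where
  "fshift a f = (\<lambda>m. f (m + axis a 1))"

definition fdiff :: "'d::finite \<Rightarrow> (int ^ 'd \<Rightarrow> 'b::minus) \<Rightarrow> int ^ 'd \<Rightarrow> 'b" where
  "fdiff a f = (\<lambda>m. fshift a f m - f m)"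

definition quasi_tau ::
    "(int ^ ('d::{finite,linorder}) \<Rightarrow> 'd smat) \<Rightarrow> nat \<Rightarrow> int ^ ('d::{finite,linorder}) \<Rightarrow> real mat" where
  "quasi_tau H k = (\<lambda>m. blk (H m) k k)"

text \<open>Only meaningful for \<open>k \<ge> 1\<close>.\<close>

definition betab ::
    "(int ^ ('d::{finite,linorder}) \<Rightarrow> 'd smat) \<Rightarrow> nat \<Rightarrow> int ^ ('d::{finite,linorder}) \<Rightarrow> real mat" where
  "betab S k = (\<lambda>m. blk (S m) k (k - 1))"

text \<open>\<open>mat_inverse\<close> returns \<open>Some\<close> exactly on invertible square matrices.\<close>

abbreviation minv :: "real mat \<Rightarrow> real mat" where
  "minv A \<equiv> the (mat_inverse A)"

end

(* Let L = n_a.Lambda - q_a. Multiplying the measure by the linear form n_a.x - q_a turns G into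
   G' = L G; since the support is a compact set on which no such form vanishes, all moments exist
   for negative exponents as well.  With R = S^-1 and Q = S R' (primes denoting the shift T_a), the
   matrix W = S' L R satisfies W S = S' L and, by G' = L G, also W H = H' Q^T.  The first relation
   makes W block upper Hessenberg and the second block upper triangular, so W is bidiagonal;
   comparing blocks gives
     H'_[k] H_[k]^-1 = beta'_[k] Lambda_[k-1,k] - Lambda_[k,k+1] beta_[k+1] - q_a,
     Delta_a beta_[k+1] = - H_[k+1] Lambda_[k,k+1]^T (H'_[k])^-1.
   Both equations of the theorem follow by inserting the second relation into the first and
   into its shifts. *)
theory Submission
  imports Defs
begin

section \<open>Finiteness of the levels and their enumeration in the prescribed order\<close>

section \<open>Multi-indices and their ordering\<close>

lemma finite_mdeg_le: "finite {\<gamma>::('d::finite) midx. mdeg \<gamma> \<le> n}"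
proof -
  have "{\<gamma>::'d midx. mdeg \<gamma> \<le> n} \<subseteq> (\<lambda>f. \<chi> i. f i) ` (UNIV \<rightarrow>\<^sub>E {..n})"
  proof
    fix \<gamma> :: "'d midx" assume "\<gamma> \<in> {\<gamma>. mdeg \<gamma> \<le> n}"
    then have "\<gamma> $ i \<le> n" for i
      using member_le_sum[of i UNIV "\<lambda>i. \<gamma> $ i"] by (auto simp: mdeg_def)
    then show "\<gamma> \<in> (\<lambda>f. \<chi> i. f i) ` (UNIV \<rightarrow>\<^sub>E {..n})"
      by (intro image_eqI[of _ _ "\<lambda>i. \<gamma> $ i"]) auto
  qed
  then show ?thesis
    by (rule finite_subset) (intro finite_imageI finite_PiE, auto)
qed

lemma finite_level: "finite (level k :: ('d::finite) midx set)"
  by (rule finite_subset[OF _ finite_mdeg_le[of k]]) (auto simp: level_def)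

lemma mem_level [simp]: "\<alpha> \<in> level k \<longleftrightarrow> mdeg \<alpha> = k"
  by (simp add: level_def)

lemma mdeg_add_axis: "mdeg (\<alpha> + axis b 1) = mdeg \<alpha> + 1"
proof -
  have "(\<Sum>i\<in>UNIV. axis b (1::nat) $ i) = (\<Sum>i\<in>UNIV. if i = b then 1 else 0)"
    by (intro sum.cong) (auto simp: axis_def)
  then show ?thesis
    by (simp add: mdeg_def sum.distrib)
qed

lemma midx_less_irrefl: "\<not> midx_less \<alpha> \<alpha>"
  by (simp add: midx_less_def)

lemma midx_less_trans:
  assumes "midx_less \<alpha> \<beta>" "midx_less \<beta> \<gamma>"
  shows "midx_less \<alpha> \<gamma>"
proof -
  from assms obtain i j where i: "\<forall>l<i. \<alpha> $ l = \<beta> $ l" "\<beta> $ i < \<alpha> $ i"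
    and j: "\<forall>l<j. \<beta> $ l = \<gamma> $ l" "\<gamma> $ j < \<beta> $ j"
    by (auto simp: midx_less_def)
  \<comment> \<open>The first coordinate where \<alpha> and \<gamma> differ is the smaller of the
    two witnesses: before it all three agree, and at it at least one of the two drops
    occurs.\<close>
  have "\<gamma> $ min i j < \<alpha> $ min i j"
    using i j by (cases i j rule: linorder_cases) (auto simp: min_def)
  moreover have "\<forall>l<min i j. \<alpha> $ l = \<gamma> $ l"
    using i j by auto
  ultimately show ?thesis
    unfolding midx_less_def by blast
qed

lemma midx_less_total:
  assumes "\<alpha> \<noteq> \<beta>"
  shows "midx_less \<alpha> \<beta> \<or> midx_less \<beta> \<alpha>"
proof -
  let ?I = "{i. \<alpha> $ i \<noteq> \<beta> $ i}"
  have "?I \<noteq> {}"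
    using assms by (auto simp: Finite_Cartesian_Product.vec_eq_iff)
  then have m: "Min ?I \<in> ?I" "\<forall>j<Min ?I. j \<notin> ?I"
    using Min_in[of ?I] Min_le[of ?I] by (simp, meson finite leD)
  then show ?thesis
    unfolding midx_less_def by (metis (mono_tags, lifting) linorder_neqE mem_Collect_eq)
qed

text \<open>Justifies the definite description in \<open>level_list\<close>. Since
  \<open>midx_less\<close> is a strict linear order, the finite set \<open>level k\<close> has
  exactly one strictly sorted enumeration.\<close>

lemma level_list_props:
  "sorted_wrt midx_less (level_list k :: ('d::{finite,linorder}) midx list)
     \<and> set (level_list k :: 'd midx list) = level k"
proof -
  interpret ml: linorder "\<lambda>\<alpha> \<beta>::'d midx. \<alpha> = \<beta> \<or> midx_less \<alpha> \<beta>" midx_less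
    by unfold_locales (use midx_less_irrefl midx_less_trans midx_less_total in blast)+
  have ex: "\<exists>!xs. sorted_wrt midx_less xs \<and> set xs = A" if "finite A" for A :: "'d midx set"
  proof (rule ex_ex1I)
    show "\<exists>xs. sorted_wrt midx_less xs \<and> set xs = A"
      using that ml.strict_sorted_list_of_set[of A] ml.set_sorted_list_of_set[of A] by blast
  qed (auto intro: ml.strict_sorted_equal)
  show ?thesis
    unfolding level_list_def by (rule theI'[OF ex[OF finite_level]])
qed

lemma set_level_list: "set (level_list k) = level k"
  using level_list_props by blast

lemma distinct_level_list: "distinct (level_list k)"
proof -
  have "sorted_wrt (\<noteq>) (level_list k)"
    by (rule sorted_wrt_mono_rel[of _ midx_less])
       (use level_list_props midx_less_irrefl in auto)
  then show ?thesis
    unfolding distinct_conv_nth sorted_wrt_iff_nth_less by (metis linorder_neqE_nat)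
qed

lemma length_level_list: "length (level_list k :: ('d::{finite,linorder}) midx list) = card (level k :: 'd midx set)"
  by (metis distinct_card distinct_level_list set_level_list)

text \<open>Lets the index sums in ordinary block products be rewritten as sums over the
  multi-indices of one degree.\<close>

lemma bij_betw_level_list:
  "bij_betw (\<lambda>i. level_list k ! i) {0..<card (level k :: ('d::{finite,linorder}) midx set)} (level k :: 'd midx set)"
  by (intro bij_betw_nth distinct_level_list)
     (simp_all add: length_level_list set_level_list lessThan_atLeast0)

lemma mdeg_level_list_nth:
  "i < card (level k :: ('d::{finite,linorder}) midx set) \<Longrightarrow> mdeg (level_list k ! i :: 'd midx) = k"
  by (metis length_level_list mem_level nth_mem set_level_list)

lemma ex_level_list_nth:
  fixes \<alpha> :: "('d::{finite,linorder}) midx"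
  assumes "mdeg \<alpha> = k"
  shows "\<exists>i<card (level k :: 'd midx set). level_list k ! i = \<alpha>"
  by (metis assms in_set_conv_nth length_level_list mem_level set_level_list)

section \<open>Band conditions under which products are finite sums and associate\<close>

section \<open>Products of semi-infinite matrices\<close>

text \<open>At most \<open>w\<close> block superdiagonals are nonzero; \<open>w = 0\<close> is block
  lower triangular. Each row then has finite support, which makes products with arbitrary right
  factors meaningful.\<close>

definition upper_band :: "nat \<Rightarrow> ('d::finite) smat \<Rightarrow> bool" where
  "upper_band w A \<longleftrightarrow> (\<forall>\<alpha> \<beta>. A \<alpha> \<beta> \<noteq> 0 \<longrightarrow> mdeg \<beta> \<le> mdeg \<alpha> + w)"

lemma upper_bandD: "upper_band w A \<Longrightarrow> mdeg \<alpha> + w < mdeg \<beta> \<Longrightarrow> A \<alpha> \<beta> = 0"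
  by (force simp: upper_band_def)

text \<open>In \<open>sm_mult\<close> the range of summation depends on the entries. A fixed finite
  superset of it makes sums of different products comparable.\<close>

lemma sm_mult_eq_sum:
  assumes "finite F" "\<And>\<gamma>. \<gamma> \<notin> F \<Longrightarrow> A \<alpha> \<gamma> * B \<gamma> \<beta> = 0"
  shows "sm_mult A B \<alpha> \<beta> = (\<Sum>\<gamma>\<in>F. A \<alpha> \<gamma> * B \<gamma> \<beta>)"
  unfolding sm_mult_def
  by (rule sum.mono_neutral_left) (use assms in auto)

text \<open>The cutoff \<open>n\<close> may exceed the actual support bound, so that one index set
  serves many rows at once.\<close>

lemma sm_mult_upper_band:
  assumes "upper_band w A" "mdeg \<alpha> + w \<le> n"
  shows "sm_mult A B \<alpha> \<beta> = (\<Sum>\<gamma> | mdeg \<gamma> \<le> n. A \<alpha> \<gamma> * B \<gamma> \<beta>)"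
  by (rule sm_mult_eq_sum) (use assms upper_bandD[OF assms(1)] in \<open>auto simp: finite_mdeg_le\<close>)

lemma sm_mult_upper_band_transpose:
  assumes "upper_band w (sm_transpose B)" "mdeg \<beta> + w \<le> n"
  shows "sm_mult A B \<alpha> \<beta> = (\<Sum>\<gamma> | mdeg \<gamma> \<le> n. A \<alpha> \<gamma> * B \<gamma> \<beta>)"
  by (rule sm_mult_eq_sum)
     (use assms upper_bandD[OF assms(1)] in \<open>auto simp: finite_mdeg_le sm_transpose_def\<close>)

lemma upper_band_sm_mult:
  assumes "upper_band w A" "upper_band v B"
  shows "upper_band (w + v) (sm_mult A B)"
  unfolding upper_band_def
proof (intro allI impI)
  fix \<alpha> \<beta> assume "sm_mult A B \<alpha> \<beta> \<noteq> 0"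
  then obtain \<gamma> where "A \<alpha> \<gamma> * B \<gamma> \<beta> \<noteq> 0"
    unfolding sm_mult_def by (rule sum.not_neutral_contains_not_neutral)
  then have "mdeg \<beta> \<le> mdeg \<gamma> + v" "mdeg \<gamma> \<le> mdeg \<alpha> + w"
    using assms by (auto simp: upper_band_def)
  then show "mdeg \<beta> \<le> mdeg \<alpha> + (w + v)"
    by simp
qed

lemma sm_transpose_transpose [simp]: "sm_transpose (sm_transpose A) = A"
  by (simp add: sm_transpose_def)

lemma sm_transpose_mult: "sm_transpose (sm_mult A B) = sm_mult (sm_transpose B) (sm_transpose A)"
  by (simp add: sm_transpose_def sm_mult_def mult.commute)

lemma sm_transpose_one [simp]: "sm_transpose sm_one = sm_one"
  by (intro ext) (auto simp: sm_transpose_def sm_one_def)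

lemma sm_mult_one_left [simp]: "sm_mult sm_one A = A"
proof (intro ext)
  fix \<alpha> \<beta> :: "'a midx"
  have "sm_mult sm_one A \<alpha> \<beta> = (\<Sum>\<gamma>\<in>{\<alpha>}. sm_one \<alpha> \<gamma> * A \<gamma> \<beta>)"
    by (rule sm_mult_eq_sum) (auto simp: sm_one_def)
  then show "sm_mult sm_one A \<alpha> \<beta> = A \<alpha> \<beta>"
    by (simp add: sm_one_def)
qed

lemma sm_mult_one_right [simp]: "sm_mult A sm_one = A"
  by (metis sm_mult_one_left sm_transpose_mult sm_transpose_one sm_transpose_transpose)

text \<open>Semi-infinite products do not associate in general. Here \<open>A\<close> and
  \<open>B\<close> have finite rows, so the double sum is finite and may be swapped, whatever
  \<open>C\<close> is.\<close>

lemma sm_mult_assoc: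
  assumes "upper_band w A" "upper_band v B"
  shows "sm_mult (sm_mult A B) C = sm_mult A (sm_mult B C)"
proof (intro ext)
  fix \<alpha> \<beta> :: "'a midx"
  define n where "n = mdeg \<alpha> + w"
  have "sm_mult (sm_mult A B) C \<alpha> \<beta> = (\<Sum>\<delta> | mdeg \<delta> \<le> n + v. sm_mult A B \<alpha> \<delta> * C \<delta> \<beta>)"
    by (rule sm_mult_upper_band[OF upper_band_sm_mult[OF assms]]) (simp add: n_def)
  also have "\<dots> = (\<Sum>\<delta> | mdeg \<delta> \<le> n + v. \<Sum>\<gamma> | mdeg \<gamma> \<le> n. A \<alpha> \<gamma> * B \<gamma> \<delta> * C \<delta> \<beta>)"
    by (simp add: sm_mult_upper_band[OF assms(1), of \<alpha> n] n_def sum_distrib_right)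
  also have "\<dots> = (\<Sum>\<gamma> | mdeg \<gamma> \<le> n. \<Sum>\<delta> | mdeg \<delta> \<le> n + v. A \<alpha> \<gamma> * B \<gamma> \<delta> * C \<delta> \<beta>)"
    by (rule sum.swap)
  also have "\<dots> = (\<Sum>\<gamma> | mdeg \<gamma> \<le> n. A \<alpha> \<gamma> * sm_mult B C \<gamma> \<beta>)"
    by (rule sum.cong)
       (auto simp: sm_mult_upper_band[OF assms(2), of _ "n + v"] sum_distrib_left mult.assoc)
  also have "\<dots> = sm_mult A (sm_mult B C) \<alpha> \<beta>"
    by (rule sm_mult_upper_band[OF assms(1), symmetric]) (simp add: n_def)
  finally show "sm_mult (sm_mult A B) C \<alpha> \<beta> = sm_mult A (sm_mult B C) \<alpha> \<beta>" .
qed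

text \<open>The companion for a right factor with finite columns, such as the transpose of a block
  lower triangular matrix: the row of \<open>A\<close> and the column of \<open>C\<close> cut off
  both summations, and \<open>B\<close> is arbitrary.\<close>

lemma sm_mult_assoc_transpose:
  assumes "upper_band w A" "upper_band v (sm_transpose C)"
  shows "sm_mult (sm_mult A B) C = sm_mult A (sm_mult B C)"
proof (intro ext)
  fix \<alpha> \<beta> :: "'a midx"
  define n k where "n = mdeg \<alpha> + w" and "k = mdeg \<beta> + v"
  have "sm_mult (sm_mult A B) C \<alpha> \<beta> = (\<Sum>\<delta> | mdeg \<delta> \<le> k. sm_mult A B \<alpha> \<delta> * C \<delta> \<beta>)"
    by (rule sm_mult_upper_band_transpose[OF assms(2)]) (simp add: k_def)
  also have "\<dots> = (\<Sum>\<delta> | mdeg \<delta> \<le> k. \<Sum>\<gamma> | mdeg \<gamma> \<le> n. A \<alpha> \<gamma> * B \<gamma> \<delta> * C \<delta> \<beta>)"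
    by (simp add: sm_mult_upper_band[OF assms(1), of \<alpha> n] n_def sum_distrib_right)
  also have "\<dots> = (\<Sum>\<gamma> | mdeg \<gamma> \<le> n. \<Sum>\<delta> | mdeg \<delta> \<le> k. A \<alpha> \<gamma> * B \<gamma> \<delta> * C \<delta> \<beta>)"
    by (rule sum.swap)
  also have "\<dots> = (\<Sum>\<gamma> | mdeg \<gamma> \<le> n. A \<alpha> \<gamma> * sm_mult B C \<gamma> \<beta>)"
    by (simp add: sm_mult_upper_band_transpose[OF assms(2), of \<beta> k] k_def sum_distrib_left mult.assoc)
  also have "\<dots> = sm_mult A (sm_mult B C) \<alpha> \<beta>"
    by (rule sm_mult_upper_band[OF assms(1), symmetric]) (simp add: n_def)
  finally show "sm_mult (sm_mult A B) C \<alpha> \<beta> = sm_mult A (sm_mult B C) \<alpha> \<beta>" .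
qed

section \<open>Passing between entries of semi-infinite matrices and their finite blocks\<close>

section \<open>Blocks\<close>

lemma blk_carrier [simp]:
  "blk (A :: ('d::{finite,linorder}) smat) k l
     \<in> carrier_mat (card (level k :: 'd midx set)) (card (level l :: 'd midx set))"
  by (simp add: blk_def)

lemma dim_blk [simp]:
  "dim_row (blk (A :: ('d::{finite,linorder}) smat) k l) = card (level k :: 'd midx set)"
  "dim_col (blk A k l) = card (level l :: 'd midx set)"
  by (simp_all add: blk_def)

lemma blk_index:
  fixes A :: "('d::{finite,linorder}) smat"
  assumes "i < card (level k :: 'd midx set)" "j < card (level l :: 'd midx set)"
  shows "blk A k l $$ (i, j) = A (level_list k ! i) (level_list l ! j)"
  using assms by (simp add: blk_def)

lemma blk_eq_iff:
  "blk A k l = blk B k l \<longleftrightarrow> (\<forall>\<alpha> \<beta>. mdeg \<alpha> = k \<longrightarrow> mdeg \<beta> = l \<longrightarrow> A \<alpha> \<beta> = B \<alpha> \<beta>)"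
proof
  assume eq: "blk A k l = blk B k l"
  show "\<forall>\<alpha> \<beta>. mdeg \<alpha> = k \<longrightarrow> mdeg \<beta> = l \<longrightarrow> A \<alpha> \<beta> = B \<alpha> \<beta>"
  proof (intro allI impI)
    fix \<alpha> \<beta> :: "'a midx" assume "mdeg \<alpha> = k" "mdeg \<beta> = l"
    then obtain i j where "i < card (level k :: 'a midx set)" "level_list k ! i = \<alpha>"
      "j < card (level l :: 'a midx set)" "level_list l ! j = \<beta>"
      using ex_level_list_nth by blast
    then show "A \<alpha> \<beta> = B \<alpha> \<beta>"
      using arg_cong[OF eq, of "\<lambda>M. M $$ (i, j)"] by (simp add: blk_index)
  qed
next
  assume "\<forall>\<alpha> \<beta>. mdeg \<alpha> = k \<longrightarrow> mdeg \<beta> = l \<longrightarrow> A \<alpha> \<beta> = B \<alpha> \<beta>"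
  then show "blk A k l = blk B k l"
    by (intro eq_matI) (auto simp: blk_def mdeg_level_list_nth)
qed

lemma blk_zero:
  "blk (\<lambda>(_ :: 'd midx) (_ :: 'd midx). 0) k l
     = 0\<^sub>m (card (level k :: ('d::{finite,linorder}) midx set)) (card (level l :: 'd midx set))"
  by (intro eq_matI) (auto simp: blk_def)

lemma blk_sm_one:
  "blk (sm_one :: 'd smat) k k = 1\<^sub>m (card (level k :: ('d::{finite,linorder}) midx set))"
  by (intro eq_matI)
     (auto simp: blk_def sm_one_def nth_eq_iff_index_eq distinct_level_list length_level_list)

lemma blk_eq_0_iff:
  fixes A :: "('d::{finite,linorder}) smat"
  shows "blk A k l = 0\<^sub>m (card (level k :: 'd midx set)) (card (level l :: 'd midx set))
     \<longleftrightarrow> (\<forall>\<alpha> \<beta>. mdeg \<alpha> = k \<longrightarrow> mdeg \<beta> = l \<longrightarrow> A \<alpha> \<beta> = 0)"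
  using blk_eq_iff[of A k l "\<lambda>_ _. 0"] by (simp add: blk_zero)

lemma blk_sm_transpose: "blk (sm_transpose A) k l = (blk A l k)\<^sup>T"
  by (intro eq_matI) (auto simp: blk_def sm_transpose_def)

lemma blk_mult_blk_index:
  fixes A B :: "('d::{finite,linorder}) smat"
  assumes "i < card (level k :: 'd midx set)" "j < card (level l :: 'd midx set)"
  shows "(blk A k p * blk B p l) $$ (i, j)
    = (\<Sum>\<gamma>\<in>level p. A (level_list k ! i) \<gamma> * B \<gamma> (level_list l ! j))"
proof -
  have "(blk A k p * blk B p l) $$ (i, j)
    = (\<Sum>r\<in>{0..<card (level p :: 'd midx set)}.
         A (level_list k ! i) (level_list p ! r) * B (level_list p ! r) (level_list l ! j))"
    using assms by (simp add: scalar_prod_def blk_def)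
  also have "\<dots> = (\<Sum>\<gamma>\<in>level p. A (level_list k ! i) \<gamma> * B \<gamma> (level_list l ! j))"
    by (rule sum.reindex_bij_betw[OF bij_betw_level_list])
  finally show ?thesis .
qed

text \<open>A block of a product is a sum over all intermediate degrees. Band conditions often leave
  only one of them, \<open>p\<close>; the next lemma treats the case of two.\<close>

lemma blk_sm_mult_single:
  fixes A B :: "('d::{finite,linorder}) smat"
  assumes "\<And>\<alpha> \<beta> \<gamma>. mdeg \<alpha> = k \<Longrightarrow> mdeg \<beta> = l \<Longrightarrow> mdeg \<gamma> \<noteq> p \<Longrightarrow> A \<alpha> \<gamma> * B \<gamma> \<beta> = 0"
  shows "blk (sm_mult A B) k l = blk A k p * blk B p l"
proof (rule eq_matI)
  fix i j assume "i < dim_row (blk A k p * blk B p l)" "j < dim_col (blk A k p * blk B p l)"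
  then have ij: "i < card (level k :: 'd midx set)" "j < card (level l :: 'd midx set)"
    by simp_all
  have "sm_mult A B (level_list k ! i) (level_list l ! j)
    = (\<Sum>\<gamma>\<in>level p. A (level_list k ! i) \<gamma> * B \<gamma> (level_list l ! j))"
    by (rule sm_mult_eq_sum) (use assms ij in \<open>auto simp: mdeg_level_list_nth finite_level\<close>)
  then show "blk (sm_mult A B) k l $$ (i, j) = (blk A k p * blk B p l) $$ (i, j)"
    unfolding blk_mult_blk_index[OF ij] using ij by (simp add: blk_index)
qed simp_all

lemma blk_sm_mult_two:
  fixes A B :: "('d::{finite,linorder}) smat"
  assumes "\<And>\<alpha> \<beta> \<gamma>. mdeg \<alpha> = k \<Longrightarrow> mdeg \<beta> = l \<Longrightarrow> mdeg \<gamma> \<noteq> p \<Longrightarrow> mdeg \<gamma> \<noteq> r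
      \<Longrightarrow> A \<alpha> \<gamma> * B \<gamma> \<beta> = 0"
    and "p \<noteq> r"
  shows "blk (sm_mult A B) k l = blk A k p * blk B p l + blk A k r * blk B r l"
proof (rule eq_matI)
  fix i j assume "i < dim_row (blk A k p * blk B p l + blk A k r * blk B r l)"
    "j < dim_col (blk A k p * blk B p l + blk A k r * blk B r l)"
  then have ij: "i < card (level k :: 'd midx set)" "j < card (level l :: 'd midx set)"
    by simp_all
  have "sm_mult A B (level_list k ! i) (level_list l ! j)
    = (\<Sum>\<gamma>\<in>level p \<union> level r. A (level_list k ! i) \<gamma> * B \<gamma> (level_list l ! j))"
    by (rule sm_mult_eq_sum) (use assms ij in \<open>auto simp: mdeg_level_list_nth finite_level\<close>)
  also have "\<dots> = (\<Sum>\<gamma>\<in>level p. A (level_list k ! i) \<gamma> * B \<gamma> (level_list l ! j))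
      + (\<Sum>\<gamma>\<in>level r. A (level_list k ! i) \<gamma> * B \<gamma> (level_list l ! j))"
    by (rule sum.union_disjoint) (use \<open>p \<noteq> r\<close> in \<open>auto simp: finite_level\<close>)
  finally show "blk (sm_mult A B) k l $$ (i, j)
      = (blk A k p * blk B p l + blk A k r * blk B r l) $$ (i, j)"
    using ij by (simp add: blk_mult_blk_index[OF ij] blk_index del: index_mult_mat(1))
qed simp_all

section \<open>How the factors change when the moment matrix is multiplied by a linear form\<close>

section \<open>Block Cholesky factors under multiplication by a linear form\<close>

text \<open>The matrix \<open>L\<close> of multiplication by the affine form v.x - c on the vector
  of monomials: L chi(x) = (v.x - c) chi(x).\<close>

definition linear_form_op :: "real ^ 'd \<Rightarrow> real \<Rightarrow> ('d::finite) smat" where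
  "linear_form_op v c = (\<lambda>\<alpha> \<beta>. dot_Lambda v \<alpha> \<beta> - c * sm_one \<alpha> \<beta>)"

lemma dot_Lambda_eq_0: "mdeg \<beta> \<noteq> mdeg \<alpha> + 1 \<Longrightarrow> dot_Lambda v \<alpha> \<beta> = 0"
  unfolding dot_Lambda_def Lambda_def by (rule sum.neutral) (use mdeg_add_axis in force)

lemma linear_form_op_eq_0:
  "mdeg \<beta> \<noteq> mdeg \<alpha> \<Longrightarrow> mdeg \<beta> \<noteq> mdeg \<alpha> + 1 \<Longrightarrow> linear_form_op v c \<alpha> \<beta> = 0"
  by (auto simp: linear_form_op_def dot_Lambda_eq_0 sm_one_def)

lemma linear_form_op_mult:
  "sm_mult (linear_form_op v c) A \<alpha> \<beta> = (\<Sum>b\<in>UNIV. v $ b * A (\<alpha> + axis b 1) \<beta>) - c * A \<alpha> \<beta>"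
proof -
  let ?F = "insert \<alpha> (range (\<lambda>b. \<alpha> + axis b 1))"
  \<comment> \<open>Keeping one indicator per direction \<open>b\<close> avoids any appeal to the
    distinctness of the shifted indices: after the sums are swapped, each \<open>b\<close> selects
    its own \<gamma>.\<close>
  have L: "dot_Lambda v \<alpha> \<gamma> * A \<gamma> \<beta> = (\<Sum>b\<in>UNIV. if \<gamma> = \<alpha> + axis b 1 then v $ b * A \<gamma> \<beta> else 0)" for \<gamma>
    unfolding dot_Lambda_def Lambda_def sum_distrib_right by (intro sum.cong) auto
  have "sm_mult (linear_form_op v c) A \<alpha> \<beta> = (\<Sum>\<gamma>\<in>?F. linear_form_op v c \<alpha> \<gamma> * A \<gamma> \<beta>)"
    by (rule sm_mult_eq_sum)
       (auto simp: linear_form_op_def dot_Lambda_def Lambda_def sm_one_def intro!: sum.neutral)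
  also have "\<dots> = (\<Sum>\<gamma>\<in>?F. dot_Lambda v \<alpha> \<gamma> * A \<gamma> \<beta>) - (\<Sum>\<gamma>\<in>?F. if \<gamma> = \<alpha> then c * A \<gamma> \<beta> else 0)"
    unfolding sum_subtractf[symmetric]
    by (intro sum.cong) (auto simp: linear_form_op_def sm_one_def algebra_simps)
  also have "(\<Sum>\<gamma>\<in>?F. if \<gamma> = \<alpha> then c * A \<gamma> \<beta> else 0) = c * A \<alpha> \<beta>"
    by (subst sum.delta) auto
  also have "(\<Sum>\<gamma>\<in>?F. dot_Lambda v \<alpha> \<gamma> * A \<gamma> \<beta>) = (\<Sum>b\<in>UNIV. v $ b * A (\<alpha> + axis b 1) \<beta>)"
    unfolding L by (subst sum.swap) (simp add: sum.delta)
  finally show ?thesis .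
qed

lemma upper_band_linear_form_op: "upper_band 1 (linear_form_op v c)"
  unfolding upper_band_def by (metis linear_form_op_eq_0 add.right_neutral le_add1 order_refl)

lemma blk_linear_form_op_diag:
  fixes v :: "real ^ ('d::{finite,linorder})"
  shows "blk (linear_form_op v c) k k = - (c \<cdot>\<^sub>m 1\<^sub>m (card (level k :: 'd midx set)))"
proof -
  have "blk (linear_form_op v c) k k = blk (\<lambda>(\<alpha> :: 'd midx) \<beta>. - c * sm_one \<alpha> \<beta>) k k"
    unfolding blk_eq_iff by (simp add: linear_form_op_def dot_Lambda_eq_0)
  also have "\<dots> = - (c \<cdot>\<^sub>m blk (sm_one :: 'd smat) k k)"
    by (intro eq_matI) (auto simp: blk_def)
  finally show ?thesis
    by (simp add: blk_sm_one)
qed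

lemma blk_linear_form_op_upper:
  "blk (linear_form_op v c) k (k + 1) = blk (dot_Lambda v) k (k + 1)"
  unfolding blk_eq_iff by (auto simp: linear_form_op_def sm_one_def)

lemma block_unitriangular_upper_band:
  assumes "block_unitriangular S"
  shows "upper_band 0 S"
  unfolding upper_band_def
proof (intro allI impI, rule ccontr)
  fix \<alpha> \<beta> assume "S \<alpha> \<beta> \<noteq> 0" "\<not> mdeg \<beta> \<le> mdeg \<alpha> + 0"
  then show False
    using assms unfolding block_unitriangular_def blk_eq_0_iff by (auto simp: not_le)
qed

lemma block_unitriangular_same_level:
  fixes S :: "('d::{finite,linorder}) smat"
  assumes "block_unitriangular S" "mdeg \<alpha> = mdeg \<beta>"
  shows "S \<alpha> \<beta> = sm_one \<alpha> \<beta>"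
proof -
  have "blk S (mdeg \<beta>) (mdeg \<beta>) = blk (sm_one :: 'd smat) (mdeg \<beta>) (mdeg \<beta>)"
    using assms(1) by (simp add: block_unitriangular_def blk_sm_one)
  then show ?thesis
    using assms(2) unfolding blk_eq_iff by auto
qed

text \<open>Forward substitution on the degree of the row. In an entry of S R = 1 above the
  diagonal, lower degrees vanish by induction, higher ones by the triangularity of \<open>S\<close>,
  and the identity block isolates the entry of \<open>R\<close>.\<close>

lemma block_unitriangular_inverse_upper_band:
  assumes S: "block_unitriangular S" and SR: "sm_mult S R = sm_one"
  shows "upper_band 0 R"
proof -
  note band = block_unitriangular_upper_band[OF S]
  have "mdeg \<alpha> < mdeg \<beta> \<Longrightarrow> R \<alpha> \<beta> = 0" for \<alpha> \<beta>
  proof (induction "mdeg \<alpha>" arbitrary: \<alpha> rule: less_induct)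
    case less
    have "S \<alpha> \<gamma> * R \<gamma> \<beta> = 0" if "\<gamma> \<notin> {\<alpha>}" for \<gamma>
    proof (cases "mdeg \<gamma>" "mdeg \<alpha>" rule: linorder_cases)
      case equal
      then show ?thesis
        using block_unitriangular_same_level[OF S, of \<alpha> \<gamma>] that by (auto simp: sm_one_def)
    qed (use less upper_bandD[OF band] in auto)
    then have "sm_mult S R \<alpha> \<beta> = (\<Sum>\<gamma>\<in>{\<alpha>}. S \<alpha> \<gamma> * R \<gamma> \<beta>)"
      by (intro sm_mult_eq_sum) auto
    also have "\<dots> = R \<alpha> \<beta>"
      using block_unitriangular_same_level[OF S, of \<alpha> \<alpha>] by (simp add: sm_one_def)
    finally show ?case
      using less.prems by (auto simp: SR sm_one_def split: if_splits)
  qed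
  then show ?thesis
    by (force simp: upper_band_def)
qed

lemma block_diagonal_eq_0:
  assumes "block_diagonal H" "mdeg \<alpha> \<noteq> mdeg \<beta>"
  shows "H \<alpha> \<beta> = 0"
  using assms unfolding block_diagonal_def blk_eq_0_iff by blast

lemma block_diagonal_upper_band: "block_diagonal H \<Longrightarrow> upper_band 0 H"
  unfolding upper_band_def by (metis block_diagonal_eq_0 add.right_neutral order_refl)

text \<open>Inverting the factorization gives H = S G S^T, which inherits the symmetry of
  \<open>G\<close>.\<close>

lemma block_cholesky_symmetric:
  assumes chol: "block_cholesky G S H" and sym: "sm_transpose G = G"
  shows "sm_transpose H = H"
proof -
  from chol obtain R where S: "block_unitriangular S" and Hd: "block_diagonal H"
    and SR: "sm_mult S R = sm_one" and G: "G = sm_mult (sm_mult R H) (sm_transpose R)"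
    by (auto simp: block_cholesky_def sm_inverse_of_def)
  note bS = block_unitriangular_upper_band[OF S]
    and bR = block_unitriangular_inverse_upper_band[OF S SR]
    and bH = block_diagonal_upper_band[OF Hd]
  have bRH: "upper_band 0 (sm_mult R H)"
    using upper_band_sm_mult[OF bR bH] by simp
  have bST: "upper_band 0 (sm_transpose (sm_transpose S))"
    by (simp add: bS)
  have RST: "sm_mult (sm_transpose R) (sm_transpose S) = sm_one"
    by (simp add: sm_transpose_mult[symmetric] SR)
  have "sm_mult S G = sm_mult H (sm_transpose R)"
    by (simp add: G sm_mult_assoc[OF bS bRH, symmetric] sm_mult_assoc[OF bS bR, symmetric] SR)
  then have H: "sm_mult (sm_mult S G) (sm_transpose S) = H"
    by (simp add: sm_mult_assoc_transpose[OF bH bST] RST)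
  have "sm_transpose (sm_mult (sm_mult S G) (sm_transpose S))
      = sm_mult (sm_mult S G) (sm_transpose S)"
    by (simp add: sm_transpose_mult sym sm_mult_assoc_transpose[OF bS bST])
  then show ?thesis
    by (simp add: H)
qed

lemma mat_eq_minus_minusI:
  fixes A X Y Z :: "'a::ab_group_add mat"
  assumes "A \<in> carrier_mat n k" "X \<in> carrier_mat n k" "Y \<in> carrier_mat n k" "Z \<in> carrier_mat n k"
    and "A + Y = X - Z"
  shows "A = X - Y - Z"
proof (rule eq_matI)
  fix i j assume "i < dim_row (X - Y - Z)" "j < dim_col (X - Y - Z)"
  then have ij: "i < n" "j < k"
    using assms by auto
  then have "A $$ (i, j) + Y $$ (i, j) = X $$ (i, j) - Z $$ (i, j)"
    using assms(1-4) arg_cong[OF assms(5), of "\<lambda>M. M $$ (i, j)"] by simp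
  then show "A $$ (i, j) = (X - Y - Z) $$ (i, j)"
    using assms(1-4) ij by (simp add: algebra_simps)
qed (use assms in auto)

lemma minv_props:
  assumes "invertible_mat A" "A \<in> carrier_mat n n"
  shows "minv A \<in> carrier_mat n n" "A * minv A = 1\<^sub>m n" "minv A * A = 1\<^sub>m n"
proof -
  obtain B where B: "mat_inverse A = Some B"
  proof (cases "mat_inverse A")
    case None
    from assms obtain B where "inverts_mat A B" "inverts_mat B A"
      by (auto simp: invertible_mat_def)
    then have "B * A = 1\<^sub>m (dim_row B)" "A * B = 1\<^sub>m n"
      using assms(2) by (auto simp: inverts_mat_def)
    \<comment> \<open>The size of \<open>B\<close> is read off from the two identity
      products.\<close>
    moreover from this have "B \<in> carrier_mat n n"
      using assms(2) by (metis carrier_matD(1) carrier_matD(2) carrier_matI index_mult_mat(2,3) index_one_mat(2,3))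
    ultimately have "A \<in> Units (ring_mat TYPE(real) n ())"
      using assms(2) by (auto simp: Units_def ring_mat_def)
    with mat_inverse(1)[OF assms(2) None] show ?thesis
      by metis
  qed auto
  then show "minv A \<in> carrier_mat n n" "A * minv A = 1\<^sub>m n" "minv A * A = 1\<^sub>m n"
    using mat_inverse(2)[OF assms(2) B] by auto
qed

lemma mult_minv_cancel_right:
  assumes "invertible_mat A" "A \<in> carrier_mat n n" "B \<in> carrier_mat k n" "C \<in> carrier_mat k n"
    "B * A = C"
  shows "B = C * minv A"
proof -
  note A = minv_props[OF assms(1,2)]
  have "C * minv A = B * (A * minv A)"
    using assms A by (metis assoc_mult_mat)
  then show ?thesis
    using assms(3) A by simp
qed

text \<open>A single flow step. The measure enters only through G' = L G and the symmetry of both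
  moment matrices. For \<open>k = 0\<close> the zero matrix stands for the absent
  \<beta>-term.\<close>

lemma block_cholesky_linear_form:
  fixes G G' S S' H H' :: "('d::{finite,linorder}) smat" and v :: "real ^ ('d::{finite,linorder})" and c :: real
  assumes chol: "block_cholesky G S H" and chol': "block_cholesky G' S' H'"
    and G': "G' = sm_mult (linear_form_op v c) G"
    and sym: "sm_transpose G = G" and sym': "sm_transpose G' = G'"
  shows "blk H' k k =
      ((if k = 0 then 0\<^sub>m (card (level k :: 'd midx set)) (card (level k :: 'd midx set))
        else blk S' k (k - 1) * blk (dot_Lambda v) (k - 1) k)
       - blk (dot_Lambda v) k (k + 1) * blk S (k + 1) k
       - c \<cdot>\<^sub>m 1\<^sub>m (card (level k :: 'd midx set))) * blk H k k"
    and "(blk S (k + 1) k - blk S' (k + 1) k) * blk H' k k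
      = blk H (k + 1) (k + 1) * (blk (dot_Lambda v) k (k + 1))\<^sup>T"
proof -
  let ?d = "\<lambda>k. card (level k :: 'd midx set)"
  define L where "L = linear_form_op v c"
  from chol obtain R where S: "block_unitriangular S" and Hd: "block_diagonal H"
    and Hinv: "\<And>k. invertible_mat (blk H k k)"
    and SR: "sm_mult S R = sm_one" and RS: "sm_mult R S = sm_one"
    and G: "G = sm_mult (sm_mult R H) (sm_transpose R)"
    by (auto simp: block_cholesky_def sm_inverse_of_def)
  from chol' obtain R' where S': "block_unitriangular S'" and Hd': "block_diagonal H'"
    and SR': "sm_mult S' R' = sm_one" and RS': "sm_mult R' S' = sm_one"
    and G'R: "G' = sm_mult (sm_mult R' H') (sm_transpose R')"
    by (auto simp: block_cholesky_def sm_inverse_of_def)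
  note bS = block_unitriangular_upper_band[OF S] and bS' = block_unitriangular_upper_band[OF S']
    and bR = block_unitriangular_inverse_upper_band[OF S SR]
    and bR' = block_unitriangular_inverse_upper_band[OF S' SR']
    and bH = block_diagonal_upper_band[OF Hd] and bH' = block_diagonal_upper_band[OF Hd']
  have bL: "upper_band 1 L"
    unfolding L_def by (rule upper_band_linear_form_op)
  have bS'L: "upper_band 1 (sm_mult S' L)" and bRH: "upper_band 0 (sm_mult R H)"
    and bRH': "upper_band 0 (sm_mult R' H')"
    using upper_band_sm_mult[OF bS' bL] upper_band_sm_mult[OF bR bH] upper_band_sm_mult[OF bR' bH']
    by simp_all
  \<comment> \<open>With the polynomial vectors p = S chi and p' = S' chi, \<open>W\<close> and
    \<open>Q\<close> are connection matrices: W p = (v.x - c) p' and p = Q p'.\<close>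
  define W where "W = sm_mult (sm_mult S' L) R"
  define Q where "Q = sm_mult S R'"
  have bW: "upper_band 1 W"
    using upper_band_sm_mult[OF bS'L bR] by (simp add: W_def)
  have bWH: "upper_band 1 (sm_mult W H)"
    using upper_band_sm_mult[OF bW bH] by simp
  have bQ: "upper_band 0 Q"
    using upper_band_sm_mult[OF bS bR'] by (simp add: Q_def)
  have WS: "sm_mult W S = sm_mult S' L"
    by (simp add: W_def sm_mult_assoc[OF bS'L bR] RS)
  have QS: "sm_mult Q S' = S"
    by (simp add: Q_def sm_mult_assoc[OF bS bR'] RS')
  have QT: "sm_transpose Q = sm_mult (sm_transpose R') (sm_transpose S)"
    by (simp add: Q_def sm_transpose_mult)
  have RST: "sm_mult (sm_transpose R) (sm_transpose S) = sm_one"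
    by (simp add: sm_transpose_mult[symmetric] SR)
  have 1: "sm_mult S' G' = sm_mult H' (sm_transpose R')"
    by (simp add: G'R sm_mult_assoc[OF bS' bRH', symmetric] sm_mult_assoc[OF bS' bR', symmetric] SR')
  have 2: "sm_mult S' G' = sm_mult (sm_mult W H) (sm_transpose R)"
    by (simp add: G' L_def[symmetric] sm_mult_assoc[OF bS' bL, symmetric] G
        sm_mult_assoc[OF bS'L bRH, symmetric] sm_mult_assoc[OF bS'L bR, symmetric] W_def)
  \<comment> \<open>The two expressions for S' G' are equated and multiplied by S^T on the right.
    That factor has finite columns, hence the second associativity law.\<close>
  have HQ: "sm_mult H' (sm_transpose Q) = sm_mult W H"
  proof -
    have "sm_mult H' (sm_transpose Q) = sm_mult (sm_mult S' G') (sm_transpose S)"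
      by (simp add: 1 QT, subst sm_mult_assoc_transpose[OF bH', of 0]) (simp_all add: bS)
    also have "\<dots> = sm_mult W H"
      by (simp add: 2, subst sm_mult_assoc_transpose[OF bWH, of 0]) (simp_all add: bS RST)
    finally show ?thesis .
  qed
  \<comment> \<open>H' Q^T has no blocks below the diagonal, and right multiplication by the
    invertible blocks of \<open>H\<close> loses nothing.\<close>
  have W_lower: "W \<alpha> \<beta> = 0" if "mdeg \<beta> < mdeg \<alpha>" for \<alpha> \<beta>
  proof -
    let ?k = "mdeg \<alpha>" and ?l = "mdeg \<beta>"
    have "blk W ?k ?l * blk H ?l ?l = blk (sm_mult W H) ?k ?l"
      by (rule blk_sm_mult_single[symmetric]) (use block_diagonal_eq_0[OF Hd] in auto)
    also have "\<dots> = blk (sm_mult H' (sm_transpose Q)) ?k ?l"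
      by (simp add: HQ)
    also have "\<dots> = blk H' ?k ?k * blk (sm_transpose Q) ?k ?l"
      by (rule blk_sm_mult_single) (use block_diagonal_eq_0[OF Hd'] in auto)
    also have "blk (sm_transpose Q) ?k ?l = 0\<^sub>m (?d ?k) (?d ?l)"
      unfolding blk_eq_0_iff by (auto simp: sm_transpose_def intro!: upper_bandD[OF bQ] that)
    finally have "blk W ?k ?l * blk H ?l ?l = 0\<^sub>m (?d ?k) (?d ?l)"
      by simp
    then have "blk W ?k ?l = 0\<^sub>m (?d ?k) (?d ?l) * minv (blk H ?l ?l)"
      by (intro mult_minv_cancel_right[OF Hinv]) auto
    also have "\<dots> = 0\<^sub>m (?d ?k) (?d ?l)"
      by (intro left_mult_zero_mat minv_props[OF Hinv]) auto
    finally show ?thesis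
      unfolding blk_eq_0_iff by blast
  qed
  have Skk: "blk S k k = 1\<^sub>m (?d k)" "blk S' k k = 1\<^sub>m (?d k)" for k
    using S S' by (auto simp: block_unitriangular_def)
  have Q_diag: "blk Q k k = 1\<^sub>m (?d k)" for k
  proof -
    have "blk (sm_mult Q S') k k = blk Q k k * blk S' k k"
      by (rule blk_sm_mult_single) (use upper_bandD[OF bQ] upper_bandD[OF bS'] in \<open>force simp: neq_iff\<close>)
    then show ?thesis
      by (simp add: QS Skk right_mult_one_mat[OF blk_carrier])
  qed
  have W_upper: "blk W k (k + 1) = blk (dot_Lambda v) k (k + 1)"
  proof -
    have "blk (sm_mult W S) k (k + 1) = blk W k (k + 1) * blk S (k + 1) (k + 1)"
      by (rule blk_sm_mult_single)
         (use upper_bandD[OF bW] upper_bandD[OF bS] in \<open>force simp: neq_iff\<close>)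
    moreover have "blk (sm_mult S' L) k (k + 1) = blk S' k k * blk L k (k + 1)"
      by (rule blk_sm_mult_single)
         (use upper_bandD[OF bS'] upper_bandD[OF bL] in \<open>force simp: neq_iff\<close>)
    ultimately show ?thesis
      by (simp add: WS Skk L_def blk_linear_form_op_upper[simplified]
          right_mult_one_mat[OF blk_carrier] left_mult_one_mat[OF blk_carrier])
  qed
  \<comment> \<open>\<open>W\<close> has only a diagonal and a superdiagonal of blocks, so two
    intermediate degrees remain.\<close>
  have "blk (sm_mult W S) k k = blk W k k * blk S k k + blk W k (k + 1) * blk S (k + 1) k"
  proof (rule blk_sm_mult_two)
    fix \<alpha> \<beta> \<gamma> :: "'d midx"
    assume "mdeg \<alpha> = k" "mdeg \<beta> = k" "mdeg \<gamma> \<noteq> k" "mdeg \<gamma> \<noteq> k + 1"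
    then show "W \<alpha> \<gamma> * S \<gamma> \<beta> = 0"
      using upper_bandD[OF bW, of \<alpha> \<gamma>] W_lower[of \<gamma> \<alpha>]
      by (cases "mdeg \<gamma> < k") auto
  qed simp
  then have W_diag: "blk W k k + blk (dot_Lambda v) k (k + 1) * blk S (k + 1) k = blk (sm_mult S' L) k k"
    by (simp add: WS Skk W_upper[simplified] right_mult_one_mat[OF blk_carrier])
  have S'L_diag: "blk (sm_mult S' L) k k =
     (if k = 0 then 0\<^sub>m (?d k) (?d k)
        else blk S' k (k - 1) * blk (dot_Lambda v) (k - 1) k) - c \<cdot>\<^sub>m 1\<^sub>m (?d k)"
  proof (cases k)
    case 0
    have "blk (sm_mult S' L) k k = blk S' k k * blk L k k"
      by (rule blk_sm_mult_single) (use upper_bandD[OF bS'] 0 in auto)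
    then show ?thesis
      by (simp add: Skk L_def blk_linear_form_op_diag 0) (intro eq_matI, auto)
  next
    case (Suc j)
    have "blk (sm_mult S' L) k k = blk S' k k * blk L k k + blk S' k j * blk L j k"
    proof (rule blk_sm_mult_two)
      fix \<alpha> \<beta> \<gamma> :: "'d midx"
      assume "mdeg \<alpha> = k" "mdeg \<beta> = k" "mdeg \<gamma> \<noteq> k" "mdeg \<gamma> \<noteq> j"
      then show "S' \<alpha> \<gamma> * L \<gamma> \<beta> = 0"
        using linear_form_op_eq_0[of \<beta> \<gamma> v c] Suc by (auto simp: L_def)
    qed (simp add: Suc)
    then show ?thesis
      using blk_linear_form_op_upper[of v c j]
      by (simp add: Skk L_def blk_linear_form_op_diag Suc) (intro eq_matI, auto)
  qed
  \<comment> \<open>The diagonal blocks of \<open>Q\<close> are identities, so the diagonal of H'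
    Q^T = W H expresses H' directly through the diagonal block of \<open>W\<close>.\<close>
  have "blk H' k k = blk (sm_mult H' (sm_transpose Q)) k k"
  proof -
    have "blk (sm_mult H' (sm_transpose Q)) k k = blk H' k k * blk (sm_transpose Q) k k"
      by (rule blk_sm_mult_single) (use block_diagonal_eq_0[OF Hd'] in auto)
    then show ?thesis
      by (simp add: blk_sm_transpose Q_diag right_mult_one_mat[OF blk_carrier])
  qed
  also have "\<dots> = blk W k k * blk H k k"
    unfolding HQ by (rule blk_sm_mult_single) (use block_diagonal_eq_0[OF Hd] in auto)
  also have "blk W k k = (if k = 0 then 0\<^sub>m (?d k) (?d k)
        else blk S' k (k - 1) * blk (dot_Lambda v) (k - 1) k)
       - blk (dot_Lambda v) k (k + 1) * blk S (k + 1) k - c \<cdot>\<^sub>m 1\<^sub>m (?d k)" (is "_ = ?X - ?Y - ?Z")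
  proof -
    have "?X \<in> carrier_mat (?d k) (?d k)" "?Y \<in> carrier_mat (?d k) (?d k)"
      "blk W k k \<in> carrier_mat (?d k) (?d k)"
      by (auto intro: mult_carrier_mat)
    moreover have "blk W k k + ?Y = ?X - ?Z"
      using W_diag S'L_diag by simp
    ultimately show ?thesis
      by (intro mat_eq_minus_minusI) auto
  qed
  finally show "blk H' k k = (?X - ?Y - ?Z) * blk H k k" .
  have Q_sub: "blk Q (k + 1) k = blk S (k + 1) k - blk S' (k + 1) k"
  proof -
    have "blk (sm_mult Q S') (k + 1) k
        = blk Q (k + 1) (k + 1) * blk S' (k + 1) k + blk Q (k + 1) k * blk S' k k"
    proof (rule blk_sm_mult_two)
      fix \<alpha> \<beta> \<gamma> :: "'d midx"
      assume "mdeg \<alpha> = k + 1" "mdeg \<beta> = k" "mdeg \<gamma> \<noteq> k + 1" "mdeg \<gamma> \<noteq> k"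
      then show "Q \<alpha> \<gamma> * S' \<gamma> \<beta> = 0"
        using upper_bandD[OF bQ, of \<alpha> \<gamma>] upper_bandD[OF bS', of \<gamma> \<beta>]
        by (cases "mdeg \<gamma> < k") auto
    qed simp
    then have "blk S (k + 1) k = blk S' (k + 1) k + blk Q (k + 1) k"
      by (simp add: QS Q_diag[simplified] Skk left_mult_one_mat[OF blk_carrier]
          right_mult_one_mat[OF blk_carrier] Q_diag[of "Suc k", simplified])
    then show ?thesis
      by simp (intro eq_matI, auto)
  qed
  have H'_sym: "(blk H' k k)\<^sup>T = blk H' k k" and H_sym: "(blk H k k)\<^sup>T = blk H k k" for k
    by (simp_all add: blk_sm_transpose[symmetric] block_cholesky_symmetric[OF chol sym]
        block_cholesky_symmetric[OF chol' sym'])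
  have "blk H' k k * blk (sm_transpose Q) k (k + 1) = blk (sm_mult H' (sm_transpose Q)) k (k + 1)"
    by (rule blk_sm_mult_single[symmetric]) (use block_diagonal_eq_0[OF Hd'] in auto)
  also have "\<dots> = blk W k (k + 1) * blk H (k + 1) (k + 1)"
    unfolding HQ by (rule blk_sm_mult_single) (use block_diagonal_eq_0[OF Hd] in auto)
  finally have eq: "blk H' k k * (blk Q (k + 1) k)\<^sup>T
      = blk (dot_Lambda v) k (k + 1) * blk H (k + 1) (k + 1)"
    unfolding W_upper blk_sm_transpose .
  \<comment> \<open>The superdiagonal of H' Q^T = W H involves the transpose of the subdiagonal
    block of \<open>Q\<close>; transposing, with symmetric \<open>H\<close> and \<open>H'\<close>,
    gives the relation for that block itself.\<close>
  have "blk Q (k + 1) k * blk H' k k = (blk H' k k * (blk Q (k + 1) k)\<^sup>T)\<^sup>T"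
    by (subst transpose_mult[of _ "?d k" "?d k" _ "?d (k + 1)"]) (simp_all add: H'_sym)
  also have "\<dots> = blk H (k + 1) (k + 1) * (blk (dot_Lambda v) k (k + 1))\<^sup>T"
    unfolding eq
    by (subst transpose_mult[of _ "?d k" "?d (k + 1)" _ "?d (k + 1)"]) (simp_all add: H_sym)
  finally show "(blk S (k + 1) k - blk S' (k + 1) k) * blk H' k k
      = blk H (k + 1) (k + 1) * (blk (dot_Lambda v) k (k + 1))\<^sup>T"
    unfolding Q_sub .
qed

section \<open>Existence of the weighted moments and their behaviour under a unit shift of
  \<open>m\<close>\<close>

section \<open>Moment matrices along the flows\<close>

lemma msupport_eq_Compl_Union:
  "- msupport M = \<Union>{U. open U \<and> emeasure M U = 0}"
  by (auto simp: msupport_def)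

lemma closed_msupport: "closed (msupport M)"
  unfolding closed_def msupport_eq_Compl_Union by blast

text \<open>The complement of the support is a union of open null sets; by the Lindelof property
  countably many of them suffice.\<close>

lemma AE_msupport:
  fixes M :: "'a::second_countable_topology measure"
  assumes "sets M = sets borel"
  shows "AE x in M. x \<in> msupport M"
proof -
  let ?N = "{U :: 'a set. open U \<and> emeasure M U = 0}"
  obtain C where C: "C \<subseteq> ?N" "countable C" "\<Union>C = \<Union>?N"
    by (rule Lindelof[of ?N]) auto
  have "(\<Union>U\<in>C. U) \<in> null_sets M"
    using C by (intro null_sets_UN') (auto simp: null_sets_def assms)
  then have "- msupport M \<in> null_sets M"
    by (simp add: msupport_eq_Compl_Union C(3))
  then show ?thesis
    by (rule AE_I') auto
qed

text \<open>The set lies in the image of a bounded box under the inverse of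
  \<open>N\<close>.\<close>

lemma bounded_parallelepiped:
  fixes N :: "real ^ 'n ^ ('n::finite)"
  assumes "invertible N"
  shows "bounded {x. \<forall>a. \<bar>(N $ a) \<bullet> x\<bar> < \<bar>q $ a\<bar>}"
proof -
  obtain N' where N': "N' ** N = Finite_Cartesian_Product.mat 1"
    using assms by (auto simp: invertible_def)
  have "bounded {y :: real ^ 'n. \<forall>a. \<bar>y $ a\<bar> < \<bar>q $ a\<bar>}"
  proof (rule bounded_subset[OF bounded_cbox], rule subsetI)
    fix y :: "real ^ 'n" assume y: "y \<in> {y. \<forall>a. \<bar>y $ a\<bar> < \<bar>q $ a\<bar>}"
    have "- \<bar>q $ a\<bar> \<le> y $ a \<and> y $ a \<le> \<bar>q $ a\<bar>" for a
      using y[simplified, rule_format, of a] by linarith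
    then show "y \<in> cbox (\<chi> a. - \<bar>q $ a\<bar>) (\<chi> a. \<bar>q $ a\<bar>)"
      by (simp add: mem_box_cart)
  qed
  then have "bounded ((\<lambda>y. N' *v y) ` {y. \<forall>a. \<bar>y $ a\<bar> < \<bar>q $ a\<bar>})"
    by (rule bounded_linear_image) (rule matrix_vector_mul_bounded_linear)
  moreover have "{x. \<forall>a. \<bar>(N $ a) \<bullet> x\<bar> < \<bar>q $ a\<bar>} \<subseteq> (\<lambda>y. N' *v y) ` {y. \<forall>a. \<bar>y $ a\<bar> < \<bar>q $ a\<bar>}"
  proof
    fix x assume "x \<in> {x. \<forall>a. \<bar>(N $ a) \<bullet> x\<bar> < \<bar>q $ a\<bar>}"
    moreover have "(N *v x) $ a = (N $ a) \<bullet> x" for a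
      by (simp add: matrix_vector_mul_component)
    moreover have "x = N' *v (N *v x)"
      by (simp add: matrix_vector_mul_assoc N')
    ultimately show "x \<in> (\<lambda>y. N' *v y) ` {y. \<forall>a. \<bar>y $ a\<bar> < \<bar>q $ a\<bar>}"
      by (intro image_eqI[of _ _ "N *v x"]) auto
  qed
  ultimately show ?thesis
    by (rule bounded_subset)
qed

lemma measurable_power_int [measurable (raw)]:
  fixes f :: "'a \<Rightarrow> real"
  assumes [measurable]: "f \<in> borel_measurable M"
  shows "(\<lambda>x. f x powi k) \<in> borel_measurable M"
  by (cases "k \<ge> 0") (simp_all add: power_int_def)

lemma borel_measurable_flow_weight: "flow_weight N q m \<in> borel_measurable borel"
  unfolding flow_weight_def[abs_def] by measurable

lemma borel_measurable_chi: "(\<lambda>x. chi x \<alpha>) \<in> borel_measurable borel"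
  unfolding chi_def[abs_def] by measurable

lemma chi_add_axis: "chi x (\<alpha> + axis b 1) = x $ b * chi x \<alpha>"
proof -
  have "chi x (\<alpha> + axis b 1) = chi x \<alpha> * (\<Prod>i\<in>UNIV. (x $ i) ^ (axis b 1 $ i))"
    by (simp add: chi_def power_add prod.distrib)
  also have "(\<Prod>i\<in>UNIV. (x $ i) ^ (axis b 1 $ i)) = (\<Prod>i\<in>UNIV. if i = b then x $ i else 1)"
    by (intro prod.cong) (auto simp: axis_def)
  finally show ?thesis
    by (simp add: mult.commute)
qed

text \<open>The form has to be nonzero at \<open>x\<close>: for exponent -1 and a vanishing form,
  the factor on the left would be \<open>0 powi 0 = 1\<close>, while the right side is 0.\<close>

lemma flow_weight_add_axis:
  assumes "(N $ a) \<bullet> x \<noteq> q $ a"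
  shows "flow_weight N q (m + axis a 1) x = ((N $ a) \<bullet> x - q $ a) * flow_weight N q m x"
proof -
  have "flow_weight N q (m + axis a 1) x
    = (\<Prod>i\<in>UNIV. ((N $ i) \<bullet> x - q $ i) powi (m $ i) * (if i = a then (N $ i) \<bullet> x - q $ i else 1))"
    unfolding flow_weight_def
    by (intro prod.cong) (use assms in \<open>auto simp: axis_def power_int_add\<close>)
  then show ?thesis
    by (simp add: prod.distrib flow_weight_def mult.commute)
qed

locale flow_measure =
  fixes N :: "real ^ 'd ^ ('d::finite)" and q :: "real ^ 'd" and \<mu> :: "(real ^ 'd) measure"
  assumes invertible: "invertible N"
    and sets: "sets \<mu> = sets borel"
    and moments: "finite_moments \<mu>"
    and support: "msupport \<mu> \<subseteq> {x. \<forall>a. \<bar>(N $ a) \<bullet> x\<bar> < \<bar>q $ a\<bar>}"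
begin

lemma support_neq: "x \<in> msupport \<mu> \<Longrightarrow> (N $ a) \<bullet> x \<noteq> q $ a"
  using support by (metis (mono_tags, lifting) less_irrefl mem_Collect_eq subsetD)

lemma compact_support: "compact (msupport \<mu>)"
  using bounded_subset[OF bounded_parallelepiped[OF invertible] support] closed_msupport
  by (auto simp: compact_eq_bounded_closed)

text \<open>On the compact support no form vanishes, so the integrand is continuous and hence
  bounded there, also for negative exponents. Bounded functions are integrable because the zeroth
  moment is finite.\<close>

lemma integrable_moment:
  "integrable \<mu> (\<lambda>x. chi x \<alpha> * chi x \<beta> * flow_weight N q m x)" (is "integrable \<mu> ?f")
proof -
  have "continuous_on (msupport \<mu>) ?f"
    unfolding chi_def flow_weight_def
    by (intro continuous_intros) (use support_neq in auto)
  then have "bounded (?f ` msupport \<mu>)"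
    by (intro compact_imp_bounded compact_continuous_image compact_support)
  then obtain B where B: "\<And>x. x \<in> msupport \<mu> \<Longrightarrow> norm (?f x) \<le> B"
    by (auto simp: bounded_iff)
  have "integrable \<mu> (\<lambda>x. chi x 0)"
    using moments by (simp add: finite_moments_def)
  then have "integrable \<mu> (\<lambda>x. B * chi x 0)"
    by (rule integrable_mult_right)
  then have "integrable \<mu> (\<lambda>x. B)"
    by (simp add: chi_def)
  moreover have "?f \<in> borel_measurable \<mu>"
    unfolding measurable_cong_sets[OF sets refl]
    by (intro borel_measurable_times borel_measurable_chi borel_measurable_flow_weight)
  ultimately show ?thesis
    by (rule Bochner_Integration.integrable_bound)
       (use AE_msupport[OF sets] B in \<open>auto elim!: eventually_mono intro: order_trans[OF _ abs_ge_self]\<close>)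
qed

text \<open>G' = L G in entries. The additional factor of the weight is absorbed into the row
  monomial, since multiplication by x_b raises \<alpha> by the unit vector e_b.\<close>

lemma moment_matrix_shift:
  "moment_matrix \<mu> N q (m + axis a 1) \<alpha> \<beta>
    = (\<Sum>b\<in>UNIV. N $ a $ b * moment_matrix \<mu> N q m (\<alpha> + axis b 1) \<beta>)
      - q $ a * moment_matrix \<mu> N q m \<alpha> \<beta>"
proof -
  let ?f = "\<lambda>\<alpha> x. chi x \<alpha> * chi x \<beta> * flow_weight N q m x"
  have "moment_matrix \<mu> N q (m + axis a 1) \<alpha> \<beta>
    = integral\<^sup>L \<mu> (\<lambda>x. (\<Sum>b\<in>UNIV. N $ a $ b * ?f (\<alpha> + axis b 1) x) - q $ a * ?f \<alpha> x)"
    unfolding moment_matrix_def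
  proof (rule integral_cong_AE)
    \<comment> \<open>Off the support a form may vanish and the shift rule for the weight may fail,
      so the integrands are compared only almost everywhere.\<close>
    show "AE x in \<mu>. chi x \<alpha> * chi x \<beta> * flow_weight N q (m + axis a 1) x
      = (\<Sum>b\<in>UNIV. N $ a $ b * ?f (\<alpha> + axis b 1) x) - q $ a * ?f \<alpha> x"
      using AE_msupport[OF sets]
    proof eventually_elim
      case (elim x)
      have "(\<Sum>b\<in>UNIV. N $ a $ b * ?f (\<alpha> + axis b 1) x) = ((N $ a) \<bullet> x) * ?f \<alpha> x"
        by (simp only: chi_add_axis inner_vec_def sum_distrib_right) (simp add: mult_ac)
      moreover have "chi x \<alpha> * chi x \<beta> * flow_weight N q (m + axis a 1) x
          = ((N $ a) \<bullet> x) * ?f \<alpha> x - q $ a * ?f \<alpha> x"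
        unfolding flow_weight_add_axis[where N = N and q = q, OF support_neq[OF elim, of a], of m]
        by (simp add: algebra_simps)
      ultimately show ?case
        by simp
    qed
  qed (intro borel_measurable_integrable integrable_moment
      Bochner_Integration.integrable_diff Bochner_Integration.integrable_sum integrable_mult_right)+
  also have "\<dots> = (\<Sum>b\<in>UNIV. N $ a $ b * moment_matrix \<mu> N q m (\<alpha> + axis b 1) \<beta>)
      - q $ a * moment_matrix \<mu> N q m \<alpha> \<beta>"
    unfolding moment_matrix_def
    by (subst Bochner_Integration.integral_diff)
       (auto intro!: integrable_moment Bochner_Integration.integrable_sum integrable_mult_right
         simp: Bochner_Integration.integral_sum integrable_moment)
  finally show ?thesis .
qed

end

section \<open>Elimination between the two one-step relations\<close>

section \<open>Toda equations\<close>

lemma diff_mult_minv: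
  assumes "invertible_mat A" "A \<in> carrier_mat n n" "X \<in> carrier_mat n n" "C = X * A"
  shows "(C - A) * minv A = X - 1\<^sub>m n"
proof -
  note A = minv_props[OF assms(1,2)]
  have "(C - A) * minv A = X * A * minv A - A * minv A"
    unfolding assms(4) using assms A by (intro minus_mult_distrib_mat) auto
  also have "X * A * minv A = X"
    using assms A by (simp add: assoc_mult_mat[of _ n n _ n _ n])
  finally show ?thesis
    by (simp add: A)
qed

text \<open>Meant for the difference of two diagonal blocks of \<open>W\<close> at neighbouring
  \<open>m\<close>: \<open>Z\<close> is the scalar matrix q_a, \<open>Y\<close> the identity, and
  both cancel.\<close>

lemma mat_diff_diff_cancel:
  fixes P1 P2 Q1 Q2 Y Z :: "'a::ab_group_add mat"
  assumes "P1 \<in> carrier_mat n k" "P2 \<in> carrier_mat n k" "Q1 \<in> carrier_mat n k"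
    "Q2 \<in> carrier_mat n k" "Y \<in> carrier_mat n k" "Z \<in> carrier_mat n k"
  shows "(P1 - Q1 - Z - Y) - (P2 - Q2 - Z - Y) = (Q2 - Q1) - (P2 - P1)"
  by (rule eq_matI) (use assms in \<open>auto simp: algebra_simps\<close>)

lemma mat_minus_swap:
  fixes A B :: "'a::ab_group_add mat"
  assumes "A \<in> carrier_mat n k" "B \<in> carrier_mat n k"
  shows "A - B = - (B - A)"
  by (rule eq_matI) (use assms in auto)

theorem theorem3p1p1:
  fixes N :: "real ^ ('d::{finite,linorder}) ^ ('d::{finite,linorder})"
    and q :: "real ^ ('d::{finite,linorder})"
    and \<mu> :: "(real ^ ('d::{finite,linorder})) measure"
    and S H :: "int ^ ('d::{finite,linorder}) \<Rightarrow> 'd smat"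
  assumes "invertible N"
    and "\<forall>a. q $ a \<noteq> 0"
    and "sets \<mu> = sets borel"
    and "finite_moments \<mu>"
    and "msupport \<mu> \<subseteq> {x. \<forall>a. \<bar>(N $ a) \<bullet> x\<bar> < \<bar>q $ a\<bar>}"
    and "\<forall>m. block_cholesky (moment_matrix \<mu> N q m) (S m) (H m)"
  shows
    "(\<forall>a b k m.
        fdiff b (\<lambda>m. fdiff a (quasi_tau H k) m * minv (quasi_tau H k m)) m =
          blk (dot_Lambda (N $ a)) k (k + 1) * quasi_tau H (k + 1) m
              * (blk (dot_Lambda (N $ b)) k (k + 1))\<^sup>T * minv (fshift b (quasi_tau H k) m)
          - (if k = 0 then 0\<^sub>m (card (level k :: 'd midx set)) (card (level k :: 'd midx set))
             else fshift a (quasi_tau H k) m * (blk (dot_Lambda (N $ b)) (k - 1) k)\<^sup>T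
                    * minv (fshift a (fshift b (quasi_tau H (k - 1))) m)
                    * blk (dot_Lambda (N $ a)) (k - 1) k))
     \<and> (\<forall>a b k m. k \<ge> 1 \<longrightarrow>
          (fshift b (betab S k) m * blk (dot_Lambda (N $ b)) (k - 1) k
             - blk (dot_Lambda (N $ b)) k (k + 1) * betab S (k + 1) m
             - q $ b \<cdot>\<^sub>m 1\<^sub>m (card (level k :: 'd midx set)))
            * fdiff a (betab S k) m
          = fshift b (fdiff a (betab S k)) m
            * ((if k = 1
                then 0\<^sub>m (card (level (k - 1) :: 'd midx set)) (card (level (k - 1) :: 'd midx set))
                else fshift a (fshift b (betab S (k - 1))) m
                       * blk (dot_Lambda (N $ b)) (k - 2) (k - 1))
               - blk (dot_Lambda (N $ b)) (k - 1) k * fshift a (betab S k) m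
               - q $ b \<cdot>\<^sub>m 1\<^sub>m (card (level (k - 1) :: 'd midx set))))"
proof -
  interpret flow_measure N q \<mu>
    using assms(1,3-5) by unfold_locales
  let ?d = "\<lambda>k. card (level k :: 'd midx set)"
  let ?G = "moment_matrix \<mu> N q"
  define h where "h k m = blk (H m) k k" for k m
  define \<beta> where "\<beta> k m = blk (S m) k (k - 1)" for k m
  define \<Lambda> where "\<Lambda> a k = blk (dot_Lambda (N $ a)) k (k + 1)" for a k
  define P where "P a k m = (if k = 0 then 0\<^sub>m (?d k) (?d k)
    else \<beta> k (m + axis a 1) * \<Lambda> a (k - 1))" for a k m
  \<comment> \<open>\<open>X a k m\<close> is the diagonal block of \<open>W\<close> for the step
    from \<open>m\<close> to m + e_a.\<close>
  define X where "X a k m = P a k m - \<Lambda> a k * \<beta> (k + 1) m - q $ a \<cdot>\<^sub>m 1\<^sub>m (?d k)" for a k m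
  have chol: "block_cholesky (?G m) (S m) (H m)" for m
    using assms(6) by blast
  have shift: "?G (m + axis a 1) = sm_mult (linear_form_op (N $ a) (q $ a)) (?G m)" for a m
    by (intro ext) (simp add: moment_matrix_shift linear_form_op_mult)
  have sym: "sm_transpose (?G m) = ?G m" for m
    by (intro ext) (simp add: sm_transpose_def moment_matrix_def mult_ac)
  have h_carrier [simp]: "h k m \<in> carrier_mat (?d k) (?d k)"
    and \<beta>_carrier [simp]: "\<beta> (Suc k) m \<in> carrier_mat (?d (Suc k)) (?d k)"
    and \<Lambda>_carrier [simp]: "\<Lambda> a k \<in> carrier_mat (?d k) (?d (Suc k))"
    and \<Lambda>T_carrier [simp]: "(\<Lambda> a k)\<^sup>T \<in> carrier_mat (?d (Suc k)) (?d k)" for k m a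
    by (simp_all add: h_def \<beta>_def \<Lambda>_def)
  have P_carrier [simp]: "P a k m \<in> carrier_mat (?d k) (?d k)" for a k m
    by (cases k) (auto simp: P_def intro: mult_carrier_mat[OF \<beta>_carrier \<Lambda>_carrier])
  have X_carrier [simp]: "X a k m \<in> carrier_mat (?d k) (?d k)" for a k m
    by (auto simp: X_def intro!: minus_carrier_mat)
  have h_inv [simp]: "invertible_mat (h k m)" for k m
    using chol by (auto simp: block_cholesky_def h_def)
  note minv_h = minv_props[OF h_inv h_carrier]
  have hX: "h k (m + axis a 1) = X a k m * h k m" for a k m
    using block_cholesky_linear_form(1)[OF chol[of m] chol[of "m + axis a 1"] shift sym sym, of k]
    by (cases k) (simp_all add: h_def X_def P_def \<beta>_def \<Lambda>_def)
  have X_eq: "X a k m = h k (m + axis a 1) * minv (h k m)" for a k m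
    by (rule mult_minv_cancel_right[OF h_inv h_carrier X_carrier h_carrier hX[symmetric]])
  \<comment> \<open>This is minus the difference of \<beta> in direction \<open>a\<close>, an
    orientation that keeps the right side free of signs.\<close>
  have \<beta>_diff: "\<beta> (Suc k) m - \<beta> (Suc k) (m + axis a 1)
      = h (Suc k) m * (\<Lambda> a k)\<^sup>T * minv (h k (m + axis a 1))" for a k m
    using block_cholesky_linear_form(2)[OF chol[of m] chol[of "m + axis a 1"] shift sym sym, of k]
    by (intro mult_minv_cancel_right[OF h_inv h_carrier minus_carrier_mat[OF \<beta>_carrier]
          mult_carrier_mat[OF h_carrier \<Lambda>T_carrier]]) (simp add: h_def \<beta>_def \<Lambda>_def)
  \<comment> \<open>Since (T_a H) H^-1 is \<open>X\<close>, the left side is the difference of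
    \<open>X\<close> in direction \<open>b\<close>. Its two varying terms each contain one \<beta>,
    and \<open>\<beta>_diff\<close> in direction \<open>b\<close> evaluates both.\<close>
  have first: "(h k (m + axis b 1 + axis a 1) - h k (m + axis b 1)) * minv (h k (m + axis b 1))
      - (h k (m + axis a 1) - h k m) * minv (h k m)
    = \<Lambda> a k * h (k + 1) m * (\<Lambda> b k)\<^sup>T * minv (h k (m + axis b 1))
      - (if k = 0 then 0\<^sub>m (?d k) (?d k)
         else h k (m + axis a 1) * (\<Lambda> b (k - 1))\<^sup>T
           * minv (h (k - 1) (m + axis a 1 + axis b 1)) * \<Lambda> a (k - 1))" (is "?lhs = ?U - ?V")
    for a b k m
  proof -
    let ?m = "m + axis b 1"
    have "?lhs = (X a k ?m - 1\<^sub>m (?d k)) - (X a k m - 1\<^sub>m (?d k))"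
      by (simp add: diff_mult_minv[OF h_inv h_carrier X_carrier hX])
    also have "\<dots> = (\<Lambda> a k * \<beta> (k + 1) m - \<Lambda> a k * \<beta> (k + 1) ?m) - (P a k m - P a k ?m)"
      unfolding X_def
      by (rule mat_diff_diff_cancel[OF P_carrier P_carrier])
         (auto intro: mult_carrier_mat[OF \<Lambda>_carrier \<beta>_carrier])
    also have "\<Lambda> a k * \<beta> (k + 1) m - \<Lambda> a k * \<beta> (k + 1) ?m = \<Lambda> a k * (\<beta> (Suc k) m - \<beta> (Suc k) ?m)"
      by (simp add: mult_minus_distrib_mat[OF \<Lambda>_carrier \<beta>_carrier \<beta>_carrier])
    also have "\<dots> = ?U"
      unfolding \<beta>_diff
      by (simp add: assoc_mult_mat[OF \<Lambda>_carrier mult_carrier_mat[OF h_carrier \<Lambda>T_carrier]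
            minv_h(1), symmetric] assoc_mult_mat[OF \<Lambda>_carrier h_carrier \<Lambda>T_carrier, symmetric])
    also have "P a k m - P a k ?m = ?V"
    proof (cases k)
      case (Suc j)
      \<comment> \<open>\<open>P\<close> contains \<beta> already shifted by e_a, so
        \<open>\<beta>_diff\<close> is applied at the base point m + e_a; this produces T_a H and
        T_a T_b H in the second term.\<close>
      have "P a k m - P a k ?m
          = (\<beta> (Suc j) (m + axis a 1) - \<beta> (Suc j) (m + axis a 1 + axis b 1)) * \<Lambda> a j"
        by (simp add: P_def Suc minus_mult_distrib_mat[OF \<beta>_carrier \<beta>_carrier \<Lambda>_carrier] add_ac)
      then show ?thesis
        unfolding \<beta>_diff by (simp add: Suc)
    qed (simp add: P_def)
    finally show ?thesis .
  qed
  \<comment> \<open>Up to a common sign both sides equal \<open>?K\<close>. On the left,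
    \<open>X\<close> turns H into T_b H. On the right, \<open>X\<close> at m + e_a is (T_a T_b
    H)(T_a H)^-1, and its first factor cancels against the inverse from
    \<open>\<beta>_diff\<close>.\<close>
  have second: "X b (Suc j) m * (\<beta> (Suc j) (m + axis a 1) - \<beta> (Suc j) m)
    = (\<beta> (Suc j) (m + axis b 1 + axis a 1) - \<beta> (Suc j) (m + axis b 1)) * X b j (m + axis a 1)"
    for a b j m
  proof -
    let ?ma = "m + axis a 1" and ?mb = "m + axis b 1" and ?mab = "m + axis b 1 + axis a 1"
    let ?K = "h (Suc j) ?mb * ((\<Lambda> a j)\<^sup>T * minv (h j ?ma))"
    have K: "(\<Lambda> a j)\<^sup>T * minv (h j ?ma) \<in> carrier_mat (?d (Suc j)) (?d j)"
      by (rule mult_carrier_mat[OF \<Lambda>T_carrier minv_h(1)])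
    have "X b (Suc j) m * (\<beta> (Suc j) m - \<beta> (Suc j) ?ma)
        = X b (Suc j) m * (h (Suc j) m * ((\<Lambda> a j)\<^sup>T * minv (h j ?ma)))"
      unfolding \<beta>_diff by (simp only: assoc_mult_mat[OF h_carrier \<Lambda>T_carrier minv_h(1)])
    also have "\<dots> = ?K"
      by (subst assoc_mult_mat[OF X_carrier h_carrier K, symmetric]) (simp add: hX)
    finally have l: "X b (Suc j) m * (\<beta> (Suc j) m - \<beta> (Suc j) ?ma) = ?K" .
    have comm: "?ma + axis b 1 = ?mab"
      by (simp add: add_ac)
    have "(\<beta> (Suc j) ?mb - \<beta> (Suc j) ?mab) * X b j ?ma
        = h (Suc j) ?mb * (\<Lambda> a j)\<^sup>T * (minv (h j ?mab) * (h j ?mab * minv (h j ?ma)))"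
      unfolding \<beta>_diff X_eq comm
      by (rule assoc_mult_mat[OF mult_carrier_mat[OF h_carrier \<Lambda>T_carrier] minv_h(1)
            mult_carrier_mat[OF h_carrier minv_h(1)]])
    also have "minv (h j ?mab) * (h j ?mab * minv (h j ?ma)) = minv (h j ?ma)"
      by (subst assoc_mult_mat[OF minv_h(1) h_carrier minv_h(1), symmetric])
         (simp add: minv_h left_mult_one_mat[OF minv_h(1)])
    also have "h (Suc j) ?mb * (\<Lambda> a j)\<^sup>T * minv (h j ?ma) = ?K"
      by (rule assoc_mult_mat[OF h_carrier \<Lambda>T_carrier minv_h(1)])
    finally have r: "(\<beta> (Suc j) ?mb - \<beta> (Suc j) ?mab) * X b j ?ma = ?K" .
    show ?thesis
      unfolding mat_minus_swap[OF \<beta>_carrier \<beta>_carrier, of j ?ma m]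
        mat_minus_swap[OF \<beta>_carrier \<beta>_carrier, of j ?mab ?mb]
      by (simp add: l r carrier_matD[OF X_carrier] carrier_matD[OF \<beta>_carrier])
  qed
  show ?thesis
  proof (intro conjI allI impI, goal_cases)
    case (1 a b k m)
    \<comment> \<open>Subtraction on naturals is truncated, so this identification holds only for
      positive \<open>k\<close>; for \<open>k = 0\<close> the term is the zero matrix.\<close>
    have "\<Lambda> c (k - 1) = blk (dot_Lambda (N $ c)) (k - 1) k" if "k \<noteq> 0" for c
      using that by (simp add: \<Lambda>_def)
    then show ?case
      using first[of k m b a]
      unfolding fdiff_def fshift_def quasi_tau_def h_def[symmetric] \<Lambda>_def[symmetric]
      by (cases "k = 0") simp_all
  next
    case (2 a b k m)
    \<comment> \<open>With k = j + 1, the case \<open>j = 0\<close> is the one in which \<beta>_[0]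
      would occur; there \<open>P\<close> is zero.\<close>
    then obtain j where k: "k = Suc j"
      by (cases k) auto
    have \<Lambda>: "blk (dot_Lambda (N $ b)) (j - 1) j = \<Lambda> b (j - 1)" if "j \<noteq> 0"
      using that by (simp add: \<Lambda>_def)
    show ?case
      using second[of b j m a] \<Lambda>
      unfolding fdiff_def fshift_def betab_def \<beta>_def[symmetric] X_def P_def
      by (cases "j = 0") (simp_all add: k \<Lambda>_def)
  qed
qed

end
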